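(* Let $(X,R)$ be a circularly ordered set and $(Y,d)$ a compact metric space. Then $BV^{\circ}_t(X,Y)$ is sequentially compact in the pointwise topology for every $t>0$. In particular, the space $M_+(X,\mathbb T)$ of all COP maps from $X$ to the circle $\mathbb T$ is sequentially compact in the pointwise topology.
   Context: A circular order on a set $X$ is a ternary relation $R\subseteq X^3$ (write $[a,b,c]$ for $(a,b,c)\in R$) satisfying: cyclicity ($[a,b,c]\Rightarrow[b,c,a]$); asymmetry ($[a,b,c]\Rightarrow (c,b,a)\notin R$); transitivity ($[a,b,c]$ and $[a,c,d]$ imply $[a,b,d]$); totality (if $a,b,c$ are distinct then $[a,b,c]$ or $[a,c,b]$). Put $[a,b]:=\{x\in X:[a,x,b]\}\cup\{a,b\}$. The circle $\mathbb T$ carries its usual topology and its standard (counterclockwise) circular order. A map $f:X_1\to X_2$ of circularly ordered sets is COP if: (COP1) whenever $[a,b,c]$ in $X_1$ and $f(a),f(b),f(c)$ are pairwise distinct, then $[f(a),f(b),f(c)]$ in $X_2$; (COP2) if $f(x)=f(y)$ then $f$ is constant on one of the closed intervals $[x,y]$, $[y,x]$. An injective cycle $[x_1,\dots,x_n]$ in $X$ is a tuple of distinct points with $[x_i,x_j,x_k]$ whenever $i,j,k$ are in the standard cyclic order of $\mathbb Z/n$. $BV^\circ_t(X,Y)$ is the set of all bounded functions $f:X\to Y$ such that $\sum_{i=1}^{n}d(f(x_i),f(x_{i+1}))\leq t$ (with $x_{n+1}=x_1$) for every injective cycle $[x_1,\dots,x_n]$ in $X$. The function spaces carry the pointwise (product)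 topology. Sequentially compact: every sequence has a subsequence converging to an element of the space. *)

theory Defs
  imports "HOL-Analysis.Analysis"
begin

definition circular_order :: "'a set \<Rightarrow> ('a \<times> 'a \<times> 'a) set \<Rightarrow> bool" where
  "circular_order X R \<longleftrightarrow>
     R \<subseteq> X \<times> X \<times> X \<and>
     (\<forall>a b c. (a, b, c) \<in> R \<longrightarrow> (b, c, a) \<in> R) \<and>
     (\<forall>a b c. (a, b, c) \<in> R \<longrightarrow> (c, b, a) \<notin> R) \<and>
     (\<forall>a b c d. (a, b, c) \<in> R \<and> (a, c, d) \<in> R \<longrightarrow> (a, b, d) \<in> R) \<and>
     (\<forall>a\<in>X. \<forall>b\<in>X. \<forall>c\<in>X. a \<noteq> b \<and> b \<noteq> c \<and> a \<noteq> c \<longrightarrow> (a, b, c) \<in> R \<or> (a, c, b) \<in> R)"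

definition circ_interval :: "'a set \<Rightarrow> ('a \<times> 'a \<times> 'a) set \<Rightarrow> 'a \<Rightarrow> 'a \<Rightarrow> 'a set" where
  "circ_interval X R a b = {x \<in> X. (a, x, b) \<in> R} \<union> {a, b}"

text \<open>A map between carriers is an extensional function, so that equality of maps is
  equality on the domain carrier, as in \<^const>\<open>product_topology\<close>.\<close>

definition COP_maps ::
  "'a set \<Rightarrow> ('a \<times> 'a \<times> 'a) set \<Rightarrow> 'b set \<Rightarrow> ('b \<times> 'b \<times> 'b) set \<Rightarrow> ('a \<Rightarrow> 'b) set" where
  "COP_maps X R Y S = {f \<in> X \<rightarrow>\<^sub>E Y.
     (\<forall>a b c. (a, b, c) \<in> R \<and> f a \<noteq> f b \<and> f b \<noteq> f c \<and> f a \<noteq> f c \<longrightarrow> (f a, f b, f c) \<in> S) \<and>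
     (\<forall>x\<in>X. \<forall>y\<in>X. f x = f y \<longrightarrow>
        f constant_on circ_interval X R x y \<or> f constant_on circ_interval X R y x)}"

text \<open>For indices in \<open>{0..<n}\<close>, the standard cyclic order of the integers modulo \<open>n\<close>.\<close>

definition cyc_nat :: "nat \<Rightarrow> nat \<Rightarrow> nat \<Rightarrow> bool" where
  "cyc_nat i j k \<longleftrightarrow> i < j \<and> j < k \<or> j < k \<and> k < i \<or> k < i \<and> i < j"

definition injective_cycle :: "'a set \<Rightarrow> ('a \<times> 'a \<times> 'a) set \<Rightarrow> 'a list \<Rightarrow> bool" where
  "injective_cycle X R xs \<longleftrightarrow>
     xs \<noteq> [] \<and> distinct xs \<and> set xs \<subseteq> X \<and>
     (\<forall>i<length xs. \<forall>j<length xs. \<forall>k<length xs.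
        cyc_nat i j k \<longrightarrow> (xs ! i, xs ! j, xs ! k) \<in> R)"

definition BV_circ ::
  "'a set \<Rightarrow> ('a \<times> 'a \<times> 'a) set \<Rightarrow> 'b set \<Rightarrow> ('b \<Rightarrow> 'b \<Rightarrow> real) \<Rightarrow> real \<Rightarrow> ('a \<Rightarrow> 'b) set" where
  "BV_circ X R Y d t = {f \<in> X \<rightarrow>\<^sub>E Y.
     Metric_space.mbounded Y d (f ` X) \<and>
     (\<forall>xs. injective_cycle X R xs \<longrightarrow>
        (\<Sum>i<length xs. d (f (xs ! i)) (f (xs ! (Suc i mod length xs)))) \<le> t)}"

text \<open>The library's \<^const>\<open>seq_compact\<close> is only available for the topology of a type class;
  this is its analogue for an abstract topological space.\<close>

definition seq_compact_space :: "'a topology \<Rightarrow> bool" where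
  "seq_compact_space T \<longleftrightarrow>
     (\<forall>\<sigma> :: nat \<Rightarrow> 'a. range \<sigma> \<subseteq> topspace T \<longrightarrow>
        (\<exists>l\<in>topspace T. \<exists>r :: nat \<Rightarrow> nat.
           strict_mono r \<and> limitin T (\<sigma> \<circ> r) l sequentially))"

definition pointwise_topology :: "'a set \<Rightarrow> 'b topology \<Rightarrow> ('a \<Rightarrow> 'b) set \<Rightarrow> ('a \<Rightarrow> 'b) topology" where
  "pointwise_topology X T F = subtopology (product_topology (\<lambda>_. T) X) F"

abbreviation unit_circle :: "complex set" where
  "unit_circle \<equiv> sphere 0 1"

text \<open>\<open>[a, b, c]\<close> holds if, running once counterclockwise around the circle starting from \<open>a\<close>,
  one meets \<open>b\<close> strictly before \<open>c\<close>.\<close>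

definition circle_order :: "(complex \<times> complex \<times> complex) set" where
  "circle_order = {(cis \<alpha>, cis \<beta>, cis \<gamma>) | \<alpha> \<beta> \<gamma>. \<alpha> < \<beta> \<and> \<beta> < \<gamma> \<and> \<gamma> < \<alpha> + 2 * pi}"

lemma cis_inj_less_2pi:
  assumes "cis x = cis y" "\<bar>x - y\<bar> < 2 * pi"
  shows "x = y"
proof -
  have "sin x = sin y \<and> cos x = cos y"
    using assms(1) by (simp add: complex_eq_iff)
  then obtain n :: int where n: "x = y + 2 * pi * n"
    using sin_cos_eq_iff[of x y] by auto
  with assms(2) have "\<bar>real_of_int n\<bar> * (2 * pi) < 1 * (2 * pi)"
    by (simp add: abs_mult mult.commute)
  then have "\<bar>real_of_int n\<bar> < 1" by (simp only: mult_less_cancel_right) simp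
  then have "n = 0" by linarith
  with n show ?thesis by simp
qed

lemma circle_orderE:
  assumes "(cis \<alpha>, b, c) \<in> circle_order"
  obtains \<beta> \<gamma> where "b = cis \<beta>" "c = cis \<gamma>" "\<alpha> < \<beta>" "\<beta> < \<gamma>" "\<gamma> < \<alpha> + 2 * pi"
proof -
  obtain \<alpha>' \<beta> \<gamma> where *: "cis \<alpha> = cis \<alpha>'" "b = cis \<beta>" "c = cis \<gamma>"
    "\<alpha>' < \<beta>" "\<beta> < \<gamma>" "\<gamma> < \<alpha>' + 2 * pi"
    using assms unfolding circle_order_def by auto
  have "sin \<alpha> = sin \<alpha>' \<and> cos \<alpha> = cos \<alpha>'"
    using *(1) by (simp add: complex_eq_iff)
  then obtain n :: int where n: "\<alpha> = \<alpha>' + 2 * pi * n"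
    using sin_cos_eq_iff[of \<alpha> \<alpha>'] by auto
  have per: "cis (x + 2 * pi * n) = cis x" for x
    using sin_cos_eq_iff[of "x + 2 * pi * n" x] by (auto simp: complex_eq_iff)
  show ?thesis
    by (rule that[of "\<beta> + 2 * pi * n" "\<gamma> + 2 * pi * n"]) (use * n per in auto)
qed

lemma circular_order_circle: "circular_order unit_circle circle_order"
  unfolding circular_order_def
proof (intro conjI allI ballI impI)
  show "circle_order \<subseteq> unit_circle \<times> unit_circle \<times> unit_circle"
    by (auto simp: circle_order_def)
next
  fix a b c assume "(a, b, c) \<in> circle_order"
  then obtain \<alpha> \<beta> \<gamma> where *: "a = cis \<alpha>" "b = cis \<beta>" "c = cis \<gamma>"
    "\<alpha> < \<beta>" "\<beta> < \<gamma>" "\<gamma> < \<alpha> + 2 * pi"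
    unfolding circle_order_def by auto
  have "cis (\<alpha> + 2 * pi) = cis \<alpha>" by (simp add: complex_eq_iff)
  with * show "(b, c, a) \<in> circle_order"
    unfolding circle_order_def by (intro CollectI exI[of _ \<beta>] exI[of _ \<gamma>] exI[of _ "\<alpha> + 2 * pi"]) auto
  show "(c, b, a) \<notin> circle_order"
  proof
    assume "(c, b, a) \<in> circle_order"
    then obtain \<beta>' \<alpha>' where **: "b = cis \<beta>'" "a = cis \<alpha>'"
      "\<gamma> < \<beta>'" "\<beta>' < \<alpha>'" "\<alpha>' < \<gamma> + 2 * pi"
      using circle_orderE *(3) by metis
    have "cis \<alpha>' = cis (\<alpha> + 2 * pi)" using * ** by (simp add: complex_eq_iff)
    then have "\<alpha>' = \<alpha> + 2 * pi"
      by (rule cis_inj_less_2pi) (use * ** in linarith)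
    then have "\<beta>' = \<beta>"
      using * ** by (intro cis_inj_less_2pi) auto
    with * ** show False by linarith
  qed
next
  fix a b c d assume "(a, b, c) \<in> circle_order \<and> (a, c, d) \<in> circle_order"
  then have 1: "(a, b, c) \<in> circle_order" and 2: "(a, c, d) \<in> circle_order" by auto
  obtain \<alpha> \<beta> \<gamma> where *: "a = cis \<alpha>" "b = cis \<beta>" "c = cis \<gamma>"
    "\<alpha> < \<beta>" "\<beta> < \<gamma>" "\<gamma> < \<alpha> + 2 * pi"
    using 1 unfolding circle_order_def by auto
  obtain \<gamma>' \<delta> where **: "c = cis \<gamma>'" "d = cis \<delta>" "\<alpha> < \<gamma>'" "\<gamma>' < \<delta>" "\<delta> < \<alpha> + 2 * pi"
    using circle_orderE 2 *(1) by metis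
  have "\<gamma>' = \<gamma>"
    using * ** by (intro cis_inj_less_2pi) auto
  with * ** show "(a, b, d) \<in> circle_order"
    unfolding circle_order_def by (intro CollectI exI[of _ \<alpha>] exI[of _ \<beta>] exI[of _ \<delta>]) auto
next
  fix a b c :: complex
  assume abc: "a \<in> unit_circle" "b \<in> unit_circle" "c \<in> unit_circle"
    and ne: "a \<noteq> b \<and> b \<noteq> c \<and> a \<noteq> c"
  obtain \<alpha> where a: "a = cis \<alpha>"
    using abc(1) complex_norm_eq_1_exp[of a] by (metis cis_conv_exp mem_sphere_0)
  have ex: "\<exists>\<beta>. z = cis \<beta> \<and> \<alpha> < \<beta> \<and> \<beta> < \<alpha> + 2 * pi" if "norm z = 1" "z \<noteq> a" for z
  proof -
    have "norm (z / a) = 1" using that a by (simp add: norm_divide)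
    then have "z / a = cis (Arg2pi (z / a))"
      using Arg2pi_eq[of "z / a"] by (simp add: cis_conv_exp mult.commute)
    then have z: "z = cis (\<alpha> + Arg2pi (z / a))"
      using a by (simp add: cis_mult[symmetric] field_simps)
    with that(2) a have "Arg2pi (z / a) \<noteq> 0" by auto
    with z show ?thesis using Arg2pi_ge_0[of "z / a"] Arg2pi_lt_2pi[of "z / a"]
      by (intro exI[of _ "\<alpha> + Arg2pi (z / a)"]) linarith
  qed
  obtain \<beta> where b: "b = cis \<beta>" "\<alpha> < \<beta>" "\<beta> < \<alpha> + 2 * pi" using ex[of b] abc ne by auto
  obtain \<gamma> where c: "c = cis \<gamma>" "\<alpha> < \<gamma>" "\<gamma> < \<alpha> + 2 * pi" using ex[of c] abc ne by auto
  have "\<beta> < \<gamma> \<or> \<gamma> < \<beta>" using b c ne by (metis linorder_neqE)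
  then show "(a, b, c) \<in> circle_order \<or> (a, c, b) \<in> circle_order"
    using a b c unfolding circle_order_def by auto
qed

end

theory Submission
  imports Defs "HOL-Library.Diagonal_Subsequence"
begin

text \<open>
  Cutting \<open>X\<close> at a point turns the circular order into a linear order. On any linear order, uniformly
  bounded monotone functions \<open>h n\<close> have a pointwise convergent subsequence: for fixed \<open>q\<close> the sets
  \<open>{x. h n x < q}\<close> are initial segments, hence form a chain; a sequence in a chain has a monotone
  subsequence, whose indicator functions converge pointwise; one diagonalizes over the rational \<open>q\<close>.
  No separability of the order is needed.

  If \<open>f\<close> has circular variation at most \<open>t\<close>, its variation \<open>V\<close> up to \<open>x\<close> along the linear order is
  monotone with values in \<open>[0, t]\<close>, and \<open>d (f x) (f y) \<le> V y - V x\<close>. Once the variations converge to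
  \<open>v\<close>, it suffices to make the functions converge on a countable set whose image under \<open>v\<close> is dense.
  A COP map to the circle is \<open>f x0 * cis (h x)\<close> for a monotone \<open>h\<close> with values in \<open>[0, 2 * pi]\<close>, so it
  is enough to select for \<open>h\<close> and \<open>f x0\<close>. Limits of COP maps are COP because \<open>[a, b, c]\<close> implies
  that the triangle \<open>f a, f b, f c\<close> has nonnegative oriented area, a closed condition.
\<close>

section \<open>Helly selection on a totally ordered set\<close>

text \<open>The peak argument for real sequences, with inclusion in place of the order. Call
  \<open>p\<close> a peak if \<open>A p\<close> contains every later set. Infinitely many peaks form
  a decreasing subsequence; otherwise, beyond some \<open>N\<close>, every set lies in a later one,
  which yields an increasing subsequence.\<close>

lemma chain_monotone_subseq:
  fixes A :: "nat \<Rightarrow> 'a set"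
  assumes chain: "\<And>m n. A m \<subseteq> A n \<or> A n \<subseteq> A m"
  obtains r :: "nat \<Rightarrow> nat" where "strict_mono r" "(\<forall>m n. m \<le> n \<longrightarrow> A (r m) \<subseteq> A (r n)) \<or> (\<forall>m n. m \<le> n \<longrightarrow> A (r n) \<subseteq> A (r m))"
proof (cases "\<forall>n. \<exists>p>n. \<forall>m\<ge>p. A m \<subseteq> A p")
  case True
  then have "\<exists>f. \<forall>n. (\<forall>m\<ge>f n. A m \<subseteq> A (f n)) \<and> f n < f (Suc n)"
    by (intro dependent_nat_choice) meson+
  then obtain f :: "nat \<Rightarrow> nat"
    where f: "strict_mono f" and dec: "\<And>n m. f n \<le> m \<Longrightarrow> A m \<subseteq> A (f n)"
    by (auto simp: strict_mono_Suc_iff)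
  show ?thesis
    using that[OF f] dec f strict_mono_less_eq by blast
next
  case False
  then obtain N where N: "\<And>p. p > N \<Longrightarrow> \<exists>m\<ge>p. \<not> A m \<subseteq> A p"
    by blast
  have next_index: "\<exists>m>p. A p \<subseteq> A m" if "p > N" for p
    using N[OF that] chain by (metis order_refl order_le_imp_less_or_eq)
  have "\<exists>f. \<forall>n. N < f n \<and> f n < f (Suc n) \<and> A (f n) \<subseteq> A (f (Suc n))"
  proof (intro dependent_nat_choice)
    fix x
    assume "N < x" with next_index[of x]
    show "\<exists>y>N. x < y \<and> A x \<subseteq> A y"
      by (auto intro: less_trans)
  qed auto
  then obtain f where "strict_mono f" "\<And>n. A (f n) \<subseteq> A (f (Suc n))"
    by (auto simp: strict_mono_Suc_iff)
  then show ?thesis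
    using that lift_Suc_mono_le[of "A \<circ> f"] by (metis comp_apply)
qed

text \<open>Along a monotone sequence of sets, membership of a fixed point changes at most
  once.\<close>

lemma chain_convergent_subseq:
  fixes A :: "nat \<Rightarrow> 'a set"
  assumes chain: "\<And>m n. A m \<subseteq> A n \<or> A n \<subseteq> A m"
  obtains r :: "nat \<Rightarrow> nat" where "strict_mono r"
    "\<And>x. (\<forall>\<^sub>F k in sequentially. x \<in> A (r k)) \<or> (\<forall>\<^sub>F k in sequentially. x \<notin> A (r k))"
proof -
  obtain r :: "nat \<Rightarrow> nat" where r: "strict_mono r" and
    mono: "(\<forall>m n. m \<le> n \<longrightarrow> A (r m) \<subseteq> A (r n)) \<or> (\<forall>m n. m \<le> n \<longrightarrow> A (r n) \<subseteq> A (r m))"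
    using chain_monotone_subseq[of A] chain by blast
  have "(\<forall>\<^sub>F k in sequentially. x \<in> A (r k)) \<or> (\<forall>\<^sub>F k in sequentially. x \<notin> A (r k))" for x
    using mono unfolding eventually_sequentially by (meson in_mono)
  with r that show ?thesis by blast
qed

text \<open>The diagonal sequence is a subsequence of the one chosen for \<open>P n\<close> only
  after finitely many terms; the assumption \<open>tail\<close> lets \<open>P n\<close> ignore
  those.\<close>

lemma diagonal_subsequence:
  fixes P :: "nat \<Rightarrow> (nat \<Rightarrow> nat) \<Rightarrow> bool"
  assumes ex: "\<And>n s. strict_mono (s :: nat \<Rightarrow> nat) \<Longrightarrow> \<exists>r. strict_mono (r :: nat \<Rightarrow> nat) \<and> P n (s \<circ> r)"
    and subseq: "\<And>n s r. strict_mono r \<Longrightarrow> P n s \<Longrightarrow> P n (s \<circ> r)"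
    and tail: "\<And>n s k. P n (s \<circ> (+) k) \<Longrightarrow> P n s"
  obtains r where "strict_mono r" "\<And>n. P n r"
proof -
  interpret subseqs P
    by unfold_locales (rule ex)
  show ?thesis
    using that[OF subseq_diagseq] diagseq_holds subseq tail by blast
qed

text \<open>Let \<open>l\<close> be the limit of some convergent subsequence. For a rational
  \<open>q\<close> different from \<open>l\<close>, the subsequence ends up on the same side of
  \<open>q\<close> as \<open>l\<close>. The whole sequence settles on one side of \<open>q\<close>,
  so it must be that side.\<close>

lemma bounded_rational_cuts_convergent:
  fixes s :: "nat \<Rightarrow> real"
  assumes bdd: "\<And>n. \<bar>s n\<bar> \<le> C"
    and cuts: "\<And>q. q \<in> \<rat> \<Longrightarrow> (\<forall>\<^sub>F k in sequentially. s k < q) \<or> (\<forall>\<^sub>F k in sequentially. \<not> s k < q)"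
  shows "convergent s"
proof -
  have "bounded (range s)"
    using bdd by (auto simp: bounded_iff)
  then obtain l r where r: "strict_mono r" and l: "(s \<circ> r) \<longlonglongrightarrow> l"
    using bounded_imp_convergent_subsequence by blast
  have subseq: "\<forall>\<^sub>F k in sequentially. Q (s (r k))" if "\<forall>\<^sub>F k in sequentially. Q (s k)" for Q
    using eventually_subseq[OF r that] .
  have False if "\<forall>\<^sub>F k in sequentially. Q k" "\<forall>\<^sub>F k in sequentially. \<not> Q k" for Q :: "nat \<Rightarrow> bool"
    using eventually_conj[OF that] by simp
  note contra = this
  have "s \<longlonglongrightarrow> l"
  proof (rule order_tendstoI)
    fix a assume "a < l"
    then obtain q where q: "q \<in> \<rat>" "a < q" "q < l" using Rats_dense_in_real by blast
    have "\<forall>\<^sub>F k in sequentially. \<not> s (r k) < q"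
      using order_tendstoD(1)[OF l q(3)] by (auto elim: eventually_mono)
    then have "\<not> (\<forall>\<^sub>F k in sequentially. s k < q)"
      using contra[of "\<lambda>k. s (r k) < q"] subseq[of "\<lambda>y. y < q"] subseq[of "\<lambda>y. \<not> y < q"] by blast
    then have "\<forall>\<^sub>F k in sequentially. \<not> s k < q"
      using cuts q(1) by blast
    then show "\<forall>\<^sub>F k in sequentially. a < s k"
      by eventually_elim (use q in auto)
  next
    fix a assume "l < a"
    then obtain q where q: "q \<in> \<rat>" "l < q" "q < a" using Rats_dense_in_real by blast
    have "\<forall>\<^sub>F k in sequentially. s (r k) < q"
      using order_tendstoD(2)[OF l q(2)] by (auto elim: eventually_mono)
    then have "\<not> (\<forall>\<^sub>F k in sequentially. \<not> s k < q)"
      using contra[of "\<lambda>k. s (r k) < q"] subseq[of "\<lambda>y. y < q"] subseq[of "\<lambda>y. \<not> y < q"] by blast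
    then have "\<forall>\<^sub>F k in sequentially. s k < q"
      using cuts q(1) by blast
    then show "\<forall>\<^sub>F k in sequentially. s k < a"
      by eventually_elim (use q in auto)
  qed
  then show ?thesis by (auto simp: convergent_def)
qed

lemma Helly_monotone:
  fixes h :: "nat \<Rightarrow> 'a \<Rightarrow> real"
  assumes total: "\<And>x y. x \<in> X \<Longrightarrow> y \<in> X \<Longrightarrow> x \<noteq> y \<Longrightarrow> lt x y \<or> lt y x"
    and mono: "\<And>n x y. x \<in> X \<Longrightarrow> y \<in> X \<Longrightarrow> lt x y \<Longrightarrow> h n x \<le> h n y"
    and bdd: "\<And>n x. x \<in> X \<Longrightarrow> \<bar>h n x\<bar> \<le> C"
  obtains r where "strict_mono r" "\<And>x. x \<in> X \<Longrightarrow> convergent (\<lambda>n. h (r n) x)"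
proof -
  define q :: "nat \<Rightarrow> real" where "q n = of_rat (nat_to_rat_surj n)" for n
  \<comment> \<open>Along \<open>s\<close>, the side of the cut \<open>q n\<close> on which the
    values lie is eventually decided at every point.\<close>
  define P where "P n s \<longleftrightarrow> (\<forall>x\<in>X. (\<forall>\<^sub>F k in sequentially. h (s k) x < q n) \<or>
    (\<forall>\<^sub>F k in sequentially. \<not> h (s k) x < q n))" for n and s :: "nat \<Rightarrow> nat"
  obtain r where r: "strict_mono r" "\<And>n. P n r"
  proof (rule diagonal_subsequence[of P])
    fix n and s :: "nat \<Rightarrow> nat"
    \<comment> \<open>If \<open>x\<close> lay only in the first set and \<open>y\<close> only in the
      second, then \<open>lt x y\<close> would contradict monotonicity of \<open>h j\<close>, and
      \<open>lt y x\<close> that of \<open>h i\<close>.\<close>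
    have "{x \<in> X. h i x < q n} \<subseteq> {x \<in> X. h j x < q n} \<or> {x \<in> X. h j x < q n} \<subseteq> {x \<in> X. h i x < q n}" for i j
    proof (rule ccontr)
      assume "\<not> ?thesis"
      then obtain x y where xy: "x \<in> X" "y \<in> X" "h i x < q n" "\<not> h j x < q n" "h j y < q n" "\<not> h i y < q n"
        by blast
      then have "lt x y \<or> lt y x" using total by metis
      then show False using xy mono by (meson order_le_less_trans)
    qed
    then obtain r where "strict_mono r"
      "\<And>x. (\<forall>\<^sub>F k in sequentially. x \<in> {x \<in> X. h (s (r k)) x < q n})
          \<or> (\<forall>\<^sub>F k in sequentially. x \<notin> {x \<in> X. h (s (r k)) x < q n})"
      using chain_convergent_subseq[of "\<lambda>k. {x \<in> X. h (s k) x < q n}"] by blast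
    then show "\<exists>r. strict_mono r \<and> P n (s \<circ> r)"
      unfolding P_def by (intro exI[of _ r]) auto
  next
    fix n and s r :: "nat \<Rightarrow> nat"
    assume r: "strict_mono r" and "P n s"
    then show "P n (s \<circ> r)"
      unfolding P_def comp_def using eventually_subseq[OF r] by blast
  next
    fix n k and s :: "nat \<Rightarrow> nat"
    assume "P n (s \<circ> (+) k)"
    then show "P n s"
      unfolding P_def comp_def
      using eventually_sequentially_seg[of "\<lambda>i. h (s i) _ < q n" k]
        eventually_sequentially_seg[of "\<lambda>i. \<not> h (s i) _ < q n" k]
      by (simp add: add.commute)
  qed blast
  have "convergent (\<lambda>n. h (r n) x)" if x: "x \<in> X" for x
  proof (rule bounded_rational_cuts_convergent)
    fix p :: real
    assume "p \<in> \<rat>"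
    then obtain n where "p = q n"
      using surj_of_rat_nat_to_rat_surj by (auto simp: q_def)
    then show "(\<forall>\<^sub>F k in sequentially. h (r k) x < p) \<or> (\<forall>\<^sub>F k in sequentially. \<not> h (r k) x < p)"
      using r(2)[of n] x by (auto simp: P_def)
  qed (use bdd x in auto)
  with r(1) that show ?thesis by blast
qed

text \<open>Let \<open>v\<close> be the limit of the \<open>h n\<close> along a subsequence, and
  \<open>D\<close> countable with \<open>v\<close> D\<open>dense in\<close>v \<open>X\<close>. Given
  \<open>x\<close>, pick \<open>z\<close> in \<open>D\<close> with \<open>v z\<close> close to
  \<open>v x\<close>. The distance of \<open>f n x\<close> and \<open>f n z\<close> is at most
  \<open>\<bar>h n z - h n x\<bar>\<close>, which is eventually small, so convergence at
  \<open>z\<close> makes the values at \<open>x\<close> a Cauchy sequence.\<close>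

lemma (in Metric_space) Helly_selection_dominated:
  fixes f :: "nat \<Rightarrow> 'c \<Rightarrow> 'a" and h :: "nat \<Rightarrow> 'c \<Rightarrow> real"
  assumes compact: "compact_space mtopology"
    and total: "\<And>x y. x \<in> X \<Longrightarrow> y \<in> X \<Longrightarrow> x \<noteq> y \<Longrightarrow> lt x y \<or> lt y x"
    and fM: "\<And>n x. x \<in> X \<Longrightarrow> f n x \<in> M"
    and dom: "\<And>n x y. x \<in> X \<Longrightarrow> y \<in> X \<Longrightarrow> lt x y \<Longrightarrow> d (f n x) (f n y) \<le> h n y - h n x"
    and bdd: "\<And>n x. x \<in> X \<Longrightarrow> \<bar>h n x\<bar> \<le> C"
  obtains r l where "strict_mono r" "\<And>x. x \<in> X \<Longrightarrow> limitin mtopology (\<lambda>n. f (r n) x) (l x) sequentially"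
proof (cases "X = {}")
  case True
  then show ?thesis using that[of id] by (simp add: strict_mono_def)
next
  case False
  have mono: "h n x \<le> h n y" if "x \<in> X" "y \<in> X" "lt x y" for n x y
    using dom[OF that, of n] nonneg[of "f n x" "f n y"] by linarith
  obtain r where r: "strict_mono r" and "\<And>x. x \<in> X \<Longrightarrow> convergent (\<lambda>n. h (r n) x)"
    using Helly_monotone[of X lt h C] total mono bdd by blast
  then obtain v where v: "\<And>x. x \<in> X \<Longrightarrow> (\<lambda>n. h (r n) x) \<longlonglongrightarrow> v x"
    unfolding convergent_def by metis
  \<comment> \<open>\<open>v\<close> may take uncountably many values, but every subset of the real
    line has a countable dense subset.\<close>
  obtain T where "countable T" "T \<subseteq> v ` X" and dense: "v ` X \<subseteq> closure T"
    using separable by blast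
  then obtain D where D: "countable D" "D \<subseteq> X" "T = v ` D"
    using countable_subset_image by metis
  have "D \<noteq> {}"
    using dense D(3) False by auto
  define e where "e = from_nat_into D"
  have eX: "e n \<in> X" for n
    using from_nat_into[OF \<open>D \<noteq> {}\<close>] D(2) by (auto simp: e_def)
  define P where "P n s \<longleftrightarrow> (\<exists>l. limitin mtopology (\<lambda>k. f (r (s k)) (e n)) l sequentially)"
    for n and s :: "nat \<Rightarrow> nat"
  obtain r' where r': "strict_mono r'" "\<And>n. P n r'"
  proof (rule diagonal_subsequence[of P])
    fix n and s :: "nat \<Rightarrow> nat"
    have "range (\<lambda>k. f (r (s k)) (e n)) \<subseteq> M" using fM eX by auto
    then show "\<exists>r. strict_mono r \<and> P n (s \<circ> r)"
      using compact unfolding compact_space_sequentially P_def comp_def by blast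
  next
    fix n and s r' :: "nat \<Rightarrow> nat"
    assume r': "strict_mono r'" and "P n s"
    then show "P n (s \<circ> r')"
      using limitin_subsequence[OF r'] unfolding P_def comp_def by fastforce
  next
    fix n k and s :: "nat \<Rightarrow> nat"
    assume "P n (s \<circ> (+) k)"
    then show "P n s"
      unfolding P_def comp_def
      using limitin_sequentially_offset_rev[of mtopology "\<lambda>i. f (r (s i)) (e n)" k]
      by (auto simp: add.commute)
  qed blast
  have "\<exists>l. limitin mtopology (\<lambda>n. f ((r \<circ> r') n) x) l sequentially" if x: "x \<in> X" for x
  proof -
    \<comment> \<open>No candidate for the limit is at hand; compactness gives completeness, so the
      Cauchy property suffices.\<close>
    have "MCauchy (\<lambda>n. f (r (r' n)) x)"
      unfolding MCauchy_def
    proof (intro conjI allI impI)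
      show "range (\<lambda>n. f (r (r' n)) x) \<subseteq> M" using fM x by auto
      fix \<epsilon> :: real assume "\<epsilon> > 0"
      \<comment> \<open>The estimate passes from \<open>x\<close> to \<open>z\<close>, between two
        indices at \<open>z\<close>, and back to \<open>x\<close>: three distances below
        \<open>\<delta>\<close>.\<close>
      define \<delta> where "\<delta> = \<epsilon> / 4"
      have "\<delta> > 0" using \<open>\<epsilon> > 0\<close> by (simp add: \<delta>_def)
      have "v x \<in> closure T" using dense x by blast
      then obtain z where z: "z \<in> D" "dist (v z) (v x) < \<delta>"
        using \<open>\<delta> > 0\<close> D(3) unfolding closure_approachable by blast
      then have zX: "z \<in> X" using D by auto
      obtain m where m: "z = e m"
        using from_nat_into_surj[OF D(1) z(1)] by (auto simp: e_def)
      obtain l where "limitin mtopology (\<lambda>k. f (r (r' k)) z) l sequentially"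
        using r'(2)[of m] by (auto simp: P_def m)
      then have "MCauchy (\<lambda>k. f (r (r' k)) z)"
        using convergent_imp_MCauchy fM zX by (metis image_subsetI)
      then obtain N1 where N1: "\<And>n n'. N1 \<le> n \<Longrightarrow> N1 \<le> n' \<Longrightarrow> d (f (r (r' n)) z) (f (r (r' n')) z) < \<delta>"
        using \<open>\<delta> > 0\<close> unfolding MCauchy_def by blast
      have "(\<lambda>k. \<bar>h (r (r' k)) z - h (r (r' k)) x\<bar>) \<longlonglongrightarrow> \<bar>v z - v x\<bar>"
        using LIMSEQ_subseq_LIMSEQ[OF v[OF zX] r'(1)] LIMSEQ_subseq_LIMSEQ[OF v[OF x] r'(1)]
        by (intro tendsto_intros) (auto simp: comp_def)
      then have "\<forall>\<^sub>F k in sequentially. \<bar>h (r (r' k)) z - h (r (r' k)) x\<bar> < \<delta>"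
        using z(2) order_tendstoD(2) by (auto simp: dist_real_def)
      then obtain N2 where N2: "\<And>n. N2 \<le> n \<Longrightarrow> \<bar>h (r (r' n)) z - h (r (r' n)) x\<bar> < \<delta>"
        unfolding eventually_sequentially by blast
      have near: "d (f (r (r' n)) x) (f (r (r' n)) z) < \<delta>" if "N2 \<le> n" for n
      proof (cases "x = z")
        case True
        then show ?thesis using \<open>\<delta> > 0\<close> fM x by simp
      next
        case False
        then show ?thesis
          using total[OF x zX] dom[OF x zX] dom[OF zX x] N2[OF that] commute
          by (smt (verit))
      qed
      show "\<exists>N. \<forall>n n'. N \<le> n \<longrightarrow> N \<le> n' \<longrightarrow> d (f (r (r' n)) x) (f (r (r' n')) x) < \<epsilon>"
      proof (intro exI allI impI)
        fix n n' assume n: "max N1 N2 \<le> n" "max N1 N2 \<le> n'"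
        let ?a = "f (r (r' n))" and ?b = "f (r (r' n'))"
        have "d (?a x) (?b x) \<le> d (?a x) (?a z) + d (?a z) (?b x)"
          using triangle fM x zX by simp
        also have "d (?a z) (?b x) \<le> d (?a z) (?b z) + d (?b z) (?b x)"
          using triangle fM x zX by simp
        finally show "d (?a x) (?b x) < \<epsilon>"
          using near[of n] near[of n'] N1[of n n'] n \<open>\<delta> > 0\<close> commute[of "?b z" "?b x"]
          unfolding \<delta>_def by simp
      qed
    qed
    then show ?thesis
      using compact_space_imp_mcomplete[OF compact] unfolding mcomplete_def comp_def by blast
  qed
  then obtain l where "\<And>x. x \<in> X \<Longrightarrow> limitin mtopology (\<lambda>n. f ((r \<circ> r') n) x) (l x) sequentially"
    by metis
  with that strict_mono_o[OF r r'(1)] show ?thesis by blast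
qed

section \<open>Sequential compactness from selection and closedness\<close>

text \<open>Convergence in the product topology is coordinatewise, so it suffices to select a
  pointwise convergent subsequence and to know that \<open>F\<close> is closed under pointwise
  limits of sequences. The point \<open>x0\<close> is offered to \<open>sel\<close> as a place to
  cut a circular order.\<close>

lemma seq_compact_space_pointwise:
  assumes F: "F \<subseteq> X \<rightarrow>\<^sub>E topspace T"
    and sel: "\<And>x0 \<sigma>. x0 \<in> X \<Longrightarrow> range \<sigma> \<subseteq> F \<Longrightarrow> \<exists>r l. strict_mono (r :: nat \<Rightarrow> nat) \<and>
      (\<forall>x\<in>X. limitin T (\<lambda>n. \<sigma> (r n) x) (l x) sequentially)"
    and closed: "\<And>\<sigma> l. range \<sigma> \<subseteq> F \<Longrightarrow> l \<in> X \<rightarrow>\<^sub>E topspace T \<Longrightarrow>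
      (\<And>x. x \<in> X \<Longrightarrow> limitin T (\<lambda>n. \<sigma> n x) (l x) sequentially) \<Longrightarrow> l \<in> F"
  shows "seq_compact_space (pointwise_topology X T F)"
  unfolding seq_compact_space_def
proof (intro allI impI)
  fix \<sigma> :: "nat \<Rightarrow> 'a \<Rightarrow> 'b"
  have top: "topspace (pointwise_topology X T F) = F"
    using F by (auto simp: pointwise_topology_def)
  assume "range \<sigma> \<subseteq> topspace (pointwise_topology X T F)"
  then have \<sigma>: "range \<sigma> \<subseteq> F" by (simp add: top)
  obtain r l where r: "strict_mono (r :: nat \<Rightarrow> nat)"
    and l: "\<And>x. x \<in> X \<Longrightarrow> limitin T (\<lambda>n. \<sigma> (r n) x) (l x) sequentially"
  proof (cases "X = {}")
    case True
    then show ?thesis using that[of id] by (simp add: strict_mono_def)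
  next
    case False
    then show ?thesis using sel \<sigma> that by blast
  qed
  \<comment> \<open>The selected limit is arbitrary outside \<open>X\<close>; restricting makes it
    extensional without changing it on \<open>X\<close>.\<close>
  let ?l = "restrict l X"
  have lE: "?l \<in> X \<rightarrow>\<^sub>E topspace T"
    using l by (auto dest: limitin_topspace)
  have "range (\<sigma> \<circ> r) \<subseteq> F" using \<sigma> by auto
  then have lF: "?l \<in> F"
    using closed[of "\<sigma> \<circ> r" ?l] lE l by simp
  have "\<sigma> n \<in> X \<rightarrow>\<^sub>E topspace T" for n
    using \<sigma> F by auto
  then have "limitin (pointwise_topology X T F) (\<sigma> \<circ> r) ?l sequentially"
    unfolding pointwise_topology_def limitin_subtopology limitin_componentwise
    using lF l \<sigma> by (auto intro!: always_eventually)
  with lF r show "\<exists>l\<in>topspace (pointwise_topology X T F). \<exists>r. strict_mono r \<and>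
      limitin (pointwise_topology X T F) (\<sigma> \<circ> r) l sequentially"
    by (auto simp: top)
qed


section \<open>Cutting a circular order at a point\<close>

lemma circular_order_cyclic: "circular_order X R \<Longrightarrow> (a, b, c) \<in> R \<Longrightarrow> (b, c, a) \<in> R"
  by (drule circular_order_def[THEN iffD1, THEN conjunct2, THEN conjunct1]) blast

lemma circular_order_asym: "circular_order X R \<Longrightarrow> (a, b, c) \<in> R \<Longrightarrow> (c, b, a) \<notin> R"
  by (drule circular_order_def[THEN iffD1, THEN conjunct2, THEN conjunct2, THEN conjunct1]) blast

lemma circular_order_trans:
  "circular_order X R \<Longrightarrow> (a, b, c) \<in> R \<Longrightarrow> (a, c, d) \<in> R \<Longrightarrow> (a, b, d) \<in> R"
  by (drule circular_order_def[THEN iffD1, THEN conjunct2, THEN conjunct2, THEN conjunct2, THEN conjunct1]) blast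

lemma circular_order_total:
  "circular_order X R \<Longrightarrow> a \<in> X \<Longrightarrow> b \<in> X \<Longrightarrow> c \<in> X \<Longrightarrow>
    a \<noteq> b \<Longrightarrow> b \<noteq> c \<Longrightarrow> a \<noteq> c \<Longrightarrow>
    (a, b, c) \<in> R \<or> (a, c, b) \<in> R"
  by (drule circular_order_def[THEN iffD1, THEN conjunct2, THEN conjunct2, THEN conjunct2, THEN conjunct2]) blast

lemma circular_order_mem:
  "circular_order X R \<Longrightarrow> (a, b, c) \<in> R \<Longrightarrow> a \<in> X \<and> b \<in> X \<and> c \<in> X"
  by (drule circular_order_def[THEN iffD1, THEN conjunct1]) blast

lemma circular_order_distinct:
  assumes co: "circular_order X R" and abc: "(a, b, c) \<in> R"
  shows "a \<noteq> b \<and> b \<noteq> c \<and> a \<noteq> c"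
proof -
  have "(b, c, a) \<in> R" "(c, a, b) \<in> R"
    using circular_order_cyclic[OF co] abc by blast+
  then show ?thesis
    using circular_order_asym[OF co] abc by blast
qed

text \<open>The linear order obtained by cutting the circle at \<open>x0\<close>, which becomes the
  least element. The case \<open>x = x0\<close> is separate because triples in a circular order have
  distinct entries.\<close>

definition cut_less :: "('a \<times> 'a \<times> 'a) set \<Rightarrow> 'a \<Rightarrow> 'a \<Rightarrow> 'a \<Rightarrow> bool" where
  "cut_less R x0 x y \<longleftrightarrow> x \<noteq> y \<and> (x = x0 \<or> (x0, x, y) \<in> R)"

lemma cut_less_total:
  assumes "circular_order X R" "x0 \<in> X" "x \<in> X" "y \<in> X" "x \<noteq> y"
  shows "cut_less R x0 x y \<or> cut_less R x0 y x"
  using circular_order_total[OF assms(1-4)] assms(5) unfolding cut_less_def by blast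

lemma cut_less_trans:
  assumes "circular_order X R" "cut_less R x0 x y" "cut_less R x0 y z"
  shows "cut_less R x0 x z"
proof -
  have "y \<noteq> x0"
    using assms(2) circular_order_distinct[OF assms(1)] by (auto simp: cut_less_def)
  then have yz: "(x0, y, z) \<in> R"
    using assms(3) by (simp add: cut_less_def)
  show ?thesis
  proof (cases "x = x0")
    case True
    then show ?thesis
      using circular_order_distinct[OF assms(1) yz] by (simp add: cut_less_def)
  next
    case False
    then have "(x0, x, z) \<in> R"
      using circular_order_trans[OF assms(1) _ yz] assms(2) by (simp add: cut_less_def)
    then show ?thesis
      using circular_order_distinct[OF assms(1)] by (auto simp: cut_less_def)
  qed
qed

text \<open>Rotated to start at \<open>y\<close>, the two relations read \<open>(y, x0, x)\<close>
  and \<open>(y, z, x0)\<close>; transitivity gives \<open>(y, z, x)\<close>, a rotation of the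
  claim.\<close>

lemma cut_less_imp_cyclic:
  assumes co: "circular_order X R" and "cut_less R x0 x y" "cut_less R x0 y z"
  shows "(x, y, z) \<in> R"
proof (cases "x = x0")
  case True
  then show ?thesis using assms unfolding cut_less_def by auto
next
  case False
  then have xy: "(x0, x, y) \<in> R" using assms(2) by (simp add: cut_less_def)
  then have "y \<noteq> x0" using circular_order_distinct[OF co] by blast
  then have yz: "(x0, y, z) \<in> R" using assms(3) by (simp add: cut_less_def)
  have "(y, z, x0) \<in> R" "(y, x0, x) \<in> R"
    using circular_order_cyclic[OF co] xy yz by blast+
  then show ?thesis
    using circular_order_cyclic[OF co] circular_order_trans[OF co] by blast
qed

text \<open>Through this lemma the bound on circular variation controls the variation along the cut
  order.\<close>

lemma cut_sorted_injective_cycle: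
  assumes co: "circular_order X R"
    and sorted: "sorted_wrt (cut_less R x0) xs" and "set xs \<subseteq> X" "xs \<noteq> []"
  shows "injective_cycle X R xs"
  unfolding injective_cycle_def
proof (intro conjI allI impI)
  have less: "cut_less R x0 (xs ! i) (xs ! j)" if "i < j" "j < length xs" for i j
    using sorted that by (simp add: sorted_wrt_iff_nth_less)
  show "distinct xs"
    unfolding distinct_conv_nth using less by (metis cut_less_def linorder_neqE_nat)
  fix i j k
  assume len: "i < length xs" "j < length xs" "k < length xs" and "cyc_nat i j k"
  have up: "(xs ! i, xs ! j, xs ! k) \<in> R" if "i < j" "j < k" "k < length xs" for i j k
    using cut_less_imp_cyclic[OF co] less that by (meson order_less_trans)
  show "(xs ! i, xs ! j, xs ! k) \<in> R"
    \<comment> \<open>The three alternatives of \<open>cyc_nat\<close> are increasing triples of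
      indices after zero, one or two rotations.\<close>
    using \<open>cyc_nat i j k\<close> unfolding cyc_nat_def
    using up[OF _ _ len(3)] circular_order_cyclic[OF co up[OF _ _ len(2)]]
      circular_order_cyclic[OF co circular_order_cyclic[OF co up[OF _ _ len(1)]]]
    by blast
qed (use assms in auto)

section \<open>Maps of bounded variation\<close>

definition path_sum :: "('b \<Rightarrow> 'b \<Rightarrow> real) \<Rightarrow> ('a \<Rightarrow> 'b) \<Rightarrow> 'a list \<Rightarrow> real" where
  "path_sum d f xs = (\<Sum>i<length xs - 1. d (f (xs ! i)) (f (xs ! Suc i)))"

definition paths_to :: "'a set \<Rightarrow> ('a \<times> 'a \<times> 'a) set \<Rightarrow> 'a \<Rightarrow> 'a \<Rightarrow> 'a list set" where
  "paths_to X R x0 x = {xs. sorted_wrt (cut_less R x0) xs \<and> set xs \<subseteq> X \<and> xs \<noteq> [] \<and> last xs = x}"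

text \<open>The variation along the cut order up to \<open>x\<close>. For \<open>f\<close> in
  \<open>BV_circ\<close> and \<open>x\<close> in \<open>X\<close> the supremum is over a nonempty
  bounded set: \<open>[x]\<close> is a path, and \<open>t\<close> bounds all sums.\<close>

definition variation ::
  "'a set \<Rightarrow> ('a \<times> 'a \<times> 'a) set \<Rightarrow> ('b \<Rightarrow> 'b \<Rightarrow> real) \<Rightarrow> 'a \<Rightarrow> ('a \<Rightarrow> 'b) \<Rightarrow> 'a \<Rightarrow> real" where
  "variation X R d x0 f x = (SUP xs\<in>paths_to X R x0 x. path_sum d f xs)"

lemma path_sum_append:
  assumes "xs \<noteq> []"
  shows "path_sum d f (xs @ [y]) = path_sum d f xs + d (f (last xs)) (f y)"
proof -
  obtain n where n: "length xs = Suc n"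
    using assms by (cases xs) auto
  have "(\<Sum>i<n. d (f ((xs @ [y]) ! i)) (f ((xs @ [y]) ! Suc i))) = (\<Sum>i<n. d (f (xs ! i)) (f (xs ! Suc i)))"
    using n by (intro sum.cong) (auto simp: nth_append)
  then show ?thesis
    using n assms by (simp add: path_sum_def nth_append last_conv_nth)
qed

text \<open>The cycle sum only adds the term that leads from the last point back to the
  first.\<close>

lemma path_sum_le_cycle_sum:
  assumes "\<And>x y. d x y \<ge> 0" "xs \<noteq> []"
  shows "path_sum d f xs \<le> (\<Sum>i<length xs. d (f (xs ! i)) (f (xs ! (Suc i mod length xs))))"
proof -
  obtain n where n: "length xs = Suc n"
    using assms by (cases xs) auto
  show ?thesis
    using assms(1) by (simp add: path_sum_def n)
qed

context Metric_space
begin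

lemma path_sum_le:
  assumes "circular_order X R" "f \<in> BV_circ X R M d t" "xs \<in> paths_to X R x0 x"
  shows "path_sum d f xs \<le> t"
  using assms path_sum_le_cycle_sum[of d xs f] cut_sorted_injective_cycle[of X R x0 xs]
  unfolding BV_circ_def paths_to_def by fastforce

lemma singleton_path: "x \<in> X \<Longrightarrow> [x] \<in> paths_to X R x0 x"
  by (simp add: paths_to_def)

lemma path_sum_le_variation:
  assumes "circular_order X R" "f \<in> BV_circ X R M d t" "xs \<in> paths_to X R x0 x"
  shows "path_sum d f xs \<le> variation X R d x0 f x"
  unfolding variation_def
  using assms path_sum_le by (intro cSUP_upper bdd_aboveI2[of _ _ t]) auto

lemma abs_variation_le:
  assumes "circular_order X R" "f \<in> BV_circ X R M d t" "x \<in> X"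
  shows "\<bar>variation X R d x0 f x\<bar> \<le> t"
proof -
  have "variation X R d x0 f x \<le> t"
    unfolding variation_def
    using singleton_path[OF assms(3), of R x0] path_sum_le[OF assms(1,2)] by (intro cSUP_least) auto
  moreover have "0 \<le> variation X R d x0 f x"
    using path_sum_le_variation[OF assms(1,2) singleton_path[OF assms(3)]] by (simp add: path_sum_def)
  ultimately show ?thesis by simp
qed

text \<open>Appending \<open>y\<close> to an increasing path that ends in \<open>x\<close> gives an
  increasing path that ends in \<open>y\<close>, and its sum grows by \<open>d (f x) (f y)\<close>.
  Then take the supremum over the paths to \<open>x\<close>.\<close>

lemma dist_le_variation_diff:
  assumes co: "circular_order X R" and f: "f \<in> BV_circ X R M d t"
    and "x \<in> X" "y \<in> X" "cut_less R x0 x y"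
  shows "d (f x) (f y) \<le> variation X R d x0 f y - variation X R d x0 f x"
proof -
  have "path_sum d f xs \<le> variation X R d x0 f y - d (f x) (f y)" if xs: "xs \<in> paths_to X R x0 x" for xs
  proof -
    have "cut_less R x0 z y" if "z \<in> set xs" for z
    proof -
      have "xs = butlast xs @ [x]" using xs by (auto simp: paths_to_def)
      moreover have "sorted_wrt (cut_less R x0) (butlast xs @ [x])"
        using xs calculation by (simp add: paths_to_def)
      ultimately have "z = x \<or> cut_less R x0 z x"
        using that by (metis Un_iff empty_iff empty_set insert_iff list.set(2) set_append sorted_wrt_append)
      then show ?thesis
        using cut_less_trans[OF co] assms(5) by blast
    qed
    then have "xs @ [y] \<in> paths_to X R x0 y"
      using xs assms(4) by (auto simp: paths_to_def sorted_wrt_append)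
    then have "path_sum d f (xs @ [y]) \<le> variation X R d x0 f y"
      by (rule path_sum_le_variation[OF co f])
    then show ?thesis
      using xs by (simp add: path_sum_append paths_to_def)
  qed
  then have "variation X R d x0 f x \<le> variation X R d x0 f y - d (f x) (f y)"
    unfolding variation_def[of X R d x0 f x]
    using singleton_path[OF assms(3)] by (intro cSUP_least) auto
  then show ?thesis by simp
qed

text \<open>By the triangle inequality, \<open>d (a n) (b n)\<close> and \<open>d x y\<close> differ
  by at most \<open>d (a n) x + d (b n) y\<close>.\<close>

lemma tendsto_mdist:
  assumes "limitin mtopology a x F" "limitin mtopology b y F"
  shows "((\<lambda>n. d (a n) (b n)) \<longlongrightarrow> d x y) F"
proof -
  have x: "x \<in> M" "\<forall>\<^sub>F n in F. a n \<in> M" "((\<lambda>n. d (a n) x) \<longlongrightarrow> 0) F"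
    and y: "y \<in> M" "\<forall>\<^sub>F n in F. b n \<in> M" "((\<lambda>n. d (b n) y) \<longlongrightarrow> 0) F"
    using assms by (auto simp: limitin_metric_dist_null)
  have "\<forall>\<^sub>F n in F. norm (d (a n) (b n) - d x y) \<le> d (a n) x + d (b n) y"
    using x(2) y(2)
  proof eventually_elim
    case (elim n)
    then show ?case
      using x(1) y(1) triangle[of "a n" x "b n"] triangle[of x y "b n"]
        triangle[of x "a n" y] triangle[of "a n" "b n" y] commute[of "a n" x] commute[of "b n" y]
      by simp
  qed
  then have "((\<lambda>n. d (a n) (b n) - d x y) \<longlongrightarrow> 0) F"
    by (rule Lim_null_comparison) (use tendsto_add[OF x(3) y(3)] in simp)
  then show ?thesis by (simp add: LIM_zero_iff)
qed

text \<open>Selection uses the variations as dominating functions. For closedness, each cycle sum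
  involves finitely many points, so its bound passes to pointwise limits.\<close>

lemma BV_circ_seq_compact:
  assumes co: "circular_order X R" and compact: "compact_space mtopology"
  shows "seq_compact_space (pointwise_topology X mtopology (BV_circ X R M d t))"
proof (rule seq_compact_space_pointwise)
  show "BV_circ X R M d t \<subseteq> X \<rightarrow>\<^sub>E topspace mtopology"
    by (auto simp: BV_circ_def)
next
  fix x0 and \<sigma> :: "nat \<Rightarrow> 'b \<Rightarrow> 'a"
  assume x0: "x0 \<in> X" and "range \<sigma> \<subseteq> BV_circ X R M d t"
  then have \<sigma>: "\<And>n. \<sigma> n \<in> BV_circ X R M d t" by blast
  obtain r l where "strict_mono r"
    "\<And>x. x \<in> X \<Longrightarrow> limitin mtopology (\<lambda>n. \<sigma> (r n) x) (l x) sequentially"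
  proof (rule Helly_selection_dominated
      [of X "cut_less R x0" \<sigma> "\<lambda>n. variation X R d x0 (\<sigma> n)" t, OF compact])
    show "\<sigma> n x \<in> M" if "x \<in> X" for n x
      using \<sigma>[of n] that by (auto simp: BV_circ_def)
  qed (use cut_less_total[OF co x0] dist_le_variation_diff[OF co \<sigma>] abs_variation_le[OF co \<sigma>] in blast)+
  then show "\<exists>r l. strict_mono (r :: nat \<Rightarrow> nat) \<and>
      (\<forall>x\<in>X. limitin mtopology (\<lambda>n. \<sigma> (r n) x) (l x) sequentially)"
    by blast
next
  fix \<sigma> :: "nat \<Rightarrow> 'b \<Rightarrow> 'a" and l
  assume "range \<sigma> \<subseteq> BV_circ X R M d t" and l: "l \<in> X \<rightarrow>\<^sub>E topspace mtopology"
    and lim: "\<And>x. x \<in> X \<Longrightarrow> limitin mtopology (\<lambda>n. \<sigma> n x) (l x) sequentially"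
  then have \<sigma>: "\<And>n. \<sigma> n \<in> BV_circ X R M d t" by blast
  \<comment> \<open>Boundedness comes from the compact space \<open>M\<close>, not from the
    functions \<open>\<sigma> n\<close>.\<close>
  have "mbounded (l ` X)"
  proof (rule mbounded_subset)
    show "mbounded M"
      using compactin_imp_mbounded[of M] compact by (simp add: compact_space_def)
    show "l ` X \<subseteq> M" using l by auto
  qed
  moreover have "(\<Sum>i<length xs. d (l (xs ! i)) (l (xs ! (Suc i mod length xs)))) \<le> t"
    if xs: "injective_cycle X R xs" for xs
  proof (rule LIMSEQ_le_const2)
    have "xs ! i \<in> X" if "i < length xs" for i
      using xs that unfolding injective_cycle_def by (meson nth_mem subsetD)
    then show "(\<lambda>n. \<Sum>i<length xs. d (\<sigma> n (xs ! i)) (\<sigma> n (xs ! (Suc i mod length xs))))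
        \<longlonglongrightarrow> (\<Sum>i<length xs. d (l (xs ! i)) (l (xs ! (Suc i mod length xs))))"
      by (intro tendsto_sum tendsto_mdist lim) (auto intro!: \<open>\<And>i. i < length xs \<Longrightarrow> xs ! i \<in> X\<close> mod_less_divisor)
    show "\<exists>N. \<forall>n\<ge>N. (\<Sum>i<length xs. d (\<sigma> n (xs ! i)) (\<sigma> n (xs ! (Suc i mod length xs)))) \<le> t"
      using \<sigma> xs by (auto simp: BV_circ_def)
  qed
  ultimately show "l \<in> BV_circ X R M d t"
    using l by (simp add: BV_circ_def)
qed

end

section \<open>Orientation of triples on the circle\<close>

text \<open>Twice the signed area of the triangle \<open>a\<close>, \<open>b\<close>,
  \<open>c\<close>, positive when it is traversed counterclockwise.\<close>

definition orient :: "complex \<Rightarrow> complex \<Rightarrow> complex \<Rightarrow> real" where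
  "orient a b c = Im (cnj (b - a) * (c - a))"

lemma orient_swap: "orient a c b = - orient a b c"
  by (simp add: orient_def algebra_simps)

text \<open>The product form shows the sign: if
  \<open>\<alpha> < \<beta> < \<gamma> < \<alpha> + 2 * pi\<close>, all three half differences lie
  strictly between \<open>0\<close> and \<open>pi\<close>.\<close>

lemma orient_cis:
  "orient (cis \<alpha>) (cis \<beta>) (cis \<gamma>) = 4 * sin ((\<beta> - \<alpha>) / 2) * sin ((\<gamma> - \<beta>) / 2) * sin ((\<gamma> - \<alpha>) / 2)"
proof -
  define a b where "a = (\<beta> - \<alpha>) / 2" and "b = (\<gamma> - \<beta>) / 2"
  have *: "\<beta> - \<alpha> = 2 * a" "\<gamma> - \<beta> = 2 * b" "\<gamma> - \<alpha> = 2 * (a + b)"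
    by (simp_all add: a_def b_def field_simps)
  have "orient (cis \<alpha>) (cis \<beta>) (cis \<gamma>) = sin (\<beta> - \<alpha>) + sin (\<gamma> - \<beta>) - sin (\<gamma> - \<alpha>)"
    by (simp add: orient_def sin_diff algebra_simps)
  also have "\<dots> = 2 * sin a * cos a + 2 * sin b * cos b - 2 * sin (a + b) * cos (a + b)"
    unfolding * sin_double by simp
  also have "\<dots> = 4 * sin a * sin b * sin (a + b)"
    using sin_cos_squared_add[of a] sin_cos_squared_add[of b] unfolding sin_add cos_add by algebra
  finally show ?thesis unfolding * by (simp only: nonzero_mult_div_cancel_left)
qed

lemma circle_order_iff_orient:
  assumes "a \<in> unit_circle" "b \<in> unit_circle" "c \<in> unit_circle"
  shows "(a, b, c) \<in> circle_order \<longleftrightarrow> orient a b c > 0"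
proof -
  have pos: "orient a b c > 0" if "(a, b, c) \<in> circle_order" for a b c
  proof -
    obtain \<alpha> \<beta> \<gamma> where *: "a = cis \<alpha>" "b = cis \<beta>" "c = cis \<gamma>" "\<alpha> < \<beta>" "\<beta> < \<gamma>" "\<gamma> < \<alpha> + 2 * pi"
      using \<open>(a, b, c) \<in> circle_order\<close> unfolding circle_order_def by auto
    show ?thesis
      unfolding *(1-3) orient_cis using *(4-6) by (intro mult_pos_pos sin_gt_zero) auto
  qed
  have "(a, b, c) \<in> circle_order" if "orient a b c > 0"
  proof -
    \<comment> \<open>Nonzero area makes the points distinct, so totality applies; the opposite
      order would make the area negative.\<close>
    have "a \<noteq> b" "b \<noteq> c" "a \<noteq> c"
      using that by (auto simp: orient_def algebra_simps)
    then have "(a, b, c) \<in> circle_order \<or> (a, c, b) \<in> circle_order"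
      using circular_order_total[OF circular_order_circle] assms by blast
    then show ?thesis
      using pos[of a c b] that orient_swap[of a c b] by auto
  qed
  with pos show ?thesis by blast
qed

text \<open>Uses that \<open>y - x\<close> is orthogonal to \<open>x + y\<close>; multiplying by \<open>\<bar>x + y\<bar>\<^sup>2\<close> avoids a division.\<close>

lemma orient_scaled:
  assumes "norm x = norm y"
  shows "(norm (x + y))\<^sup>2 * orient x u y = 2 * Im (y * cnj x) * Re (cnj (u - x) * (x + y))"
proof -
  have "(Re x)\<^sup>2 + (Im x)\<^sup>2 = (Re y)\<^sup>2 + (Im y)\<^sup>2"
    using assms by (metis cmod_power2)
  then show ?thesis
    unfolding orient_def cmod_power2 by simp algebra
qed

section \<open>COP maps to the circle\<close>

abbreviation circle_COP :: "'a set \<Rightarrow> ('a \<times> 'a \<times> 'a) set \<Rightarrow> ('a \<Rightarrow> complex) set" where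
  "circle_COP X R \<equiv> COP_maps X R unit_circle circle_order"

lemma COP_maps_constant:
  assumes "f \<in> COP_maps X R Y S" "x \<in> X" "y \<in> X" "f x = f y"
  shows "(\<forall>u\<in>X. (x, u, y) \<in> R \<longrightarrow> f u = f x) \<or> (\<forall>u\<in>X. (y, u, x) \<in> R \<longrightarrow> f u = f x)"
proof -
  have "f constant_on circ_interval X R x y \<or> f constant_on circ_interval X R y x"
    using assms by (simp add: COP_maps_def)
  then show ?thesis
    by (auto simp: constant_on_def circ_interval_def)
qed

text \<open>If two of the values coincide, the triangle is degenerate and has area \<open>0\<close>;
  otherwise (COP1) applies.\<close>

lemma circle_COP_orient_nonneg:
  assumes co: "circular_order X R" and f: "f \<in> circle_COP X R" and abc: "(a, b, c) \<in> R"
  shows "orient (f a) (f b) (f c) \<ge> 0"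
proof (cases "f a \<noteq> f b \<and> f b \<noteq> f c \<and> f a \<noteq> f c")
  case True
  then have "(f a, f b, f c) \<in> circle_order"
    using f abc by (simp add: COP_maps_def)
  moreover have "f a \<in> unit_circle" "f b \<in> unit_circle" "f c \<in> unit_circle"
    using f circular_order_mem[OF co abc] unfolding COP_maps_def by blast+
  ultimately show ?thesis
    using circle_order_iff_orient by fastforce
next
  case False
  then show ?thesis by (auto simp: orient_def algebra_simps)
qed

text \<open>Excludes, near a limit with \<open>f x = f y\<close>, that \<open>f\<close> leaves this value on both arcs between \<open>x\<close>
  and \<open>y\<close>: the first two conditions hold when \<open>f x\<close> and \<open>f y\<close> are close together and \<open>f u\<close>, \<open>f v\<close>
  stay away from them.\<close>

lemma circle_COP_close_endpoints:
  assumes co: "circular_order X R" and f: "f \<in> circle_COP X R"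
    and u: "(x, u, y) \<in> R" and v: "(y, v, x) \<in> R"
    and A: "Re (cnj (f u - f x) * (f x + f y)) < 0"
    and B: "Re (cnj (f v - f y) * (f y + f x)) < 0"
  shows "Re (f y * cnj (f x)) \<le> 0"
proof (rule ccontr)
  assume pos: "\<not> ?thesis"
  have X: "x \<in> X" "u \<in> X" "y \<in> X" "v \<in> X"
    using circular_order_mem[OF co] u v by auto
  have norm: "norm (f x) = 1" "norm (f y) = 1"
    using f X unfolding COP_maps_def by auto
  \<comment> \<open>By \<open>orient_scaled\<close> this product is a square times an orientation.
    Its last factor is negative by \<open>A\<close>, which fixes the sign of the imaginary
    part.\<close>
  have "2 * Im (f y * cnj (f x)) * Re (cnj (f u - f x) * (f x + f y)) \<ge> 0"
    using orient_scaled[of "f x" "f y" "f u"] norm circle_COP_orient_nonneg[OF co f u]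
    by (metis mult_nonneg_nonneg zero_le_power2)
  then have "Im (f y * cnj (f x)) \<le> 0"
    using A by (simp add: zero_le_mult_iff)
  moreover have "2 * Im (f x * cnj (f y)) * Re (cnj (f v - f y) * (f y + f x)) \<ge> 0"
    using orient_scaled[of "f y" "f x" "f v"] norm circle_COP_orient_nonneg[OF co f v]
    by (metis mult_nonneg_nonneg zero_le_power2)
  then have "Im (f x * cnj (f y)) \<le> 0"
    using B by (simp add: zero_le_mult_iff)
  \<comment> \<open>The two numbers are conjugate, so both bounds together make the imaginary part
    vanish. A real number of modulus 1 that is positive equals 1, hence
    \<open>f x = f y\<close>.\<close>
  ultimately have Im: "Im (f y * cnj (f x)) = 0"
    by (simp add: algebra_simps)
  have "norm (f y * cnj (f x)) = 1"
    using norm by (simp add: norm_mult)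
  then have "\<bar>Re (f y * cnj (f x))\<bar> = 1"
    using Im by (simp only: cmod_eq_Re)
  then have "f y * cnj (f x) = 1"
    using Im pos by (simp add: complex_eq_iff)
  moreover have "f x * cnj (f x) = 1"
    using norm by (simp add: complex_norm_square[symmetric])
  ultimately have "f x = f y"
    by (metis mult.commute mult.left_commute mult.right_neutral)
  \<comment> \<open>(COP2) makes \<open>f\<close> constant on one of the two arcs; then the factor
    \<open>f u - f x\<close> in \<open>A\<close> or \<open>f v - f y\<close> in \<open>B\<close> is
    \<open>0\<close>.\<close>
  then consider "f u = f x" | "f v = f x"
    using COP_maps_constant[OF f X(1,3)] X u v by blast
  then show False
    using A B \<open>f x = f y\<close> by cases auto
qed

text \<open>(COP1) follows from the limit of the orientations. If (COP2) failed for
  \<open>l x = l y\<close>, with \<open>u\<close> and \<open>v\<close> on the two arcs, the maps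
  \<open>\<sigma> n\<close> would for large \<open>n\<close> contradict
  \<open>circle_COP_close_endpoints\<close>.\<close>

lemma circle_COP_closed:
  assumes co: "circular_order X R" and \<sigma>: "\<And>n. \<sigma> n \<in> circle_COP X R"
    and l: "l \<in> X \<rightarrow>\<^sub>E unit_circle" and lim: "\<And>x. x \<in> X \<Longrightarrow> (\<lambda>n. \<sigma> n x) \<longlonglongrightarrow> l x"
  shows "l \<in> circle_COP X R"
proof -
  have mem: "l x \<in> unit_circle" if "x \<in> X" for x
    using l that by blast
  have cop1: "(l a, l b, l c) \<in> circle_order"
    if abc: "(a, b, c) \<in> R" and ne: "l a \<noteq> l b" "l b \<noteq> l c" "l a \<noteq> l c" for a b c
  proof -
    have X: "a \<in> X" "b \<in> X" "c \<in> X"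
      using circular_order_mem[OF co abc] by auto
    have "(\<lambda>n. orient (\<sigma> n a) (\<sigma> n b) (\<sigma> n c)) \<longlonglongrightarrow> orient (l a) (l b) (l c)"
      unfolding orient_def using X by (intro tendsto_intros lim)
    then have "orient (l a) (l b) (l c) \<ge> 0"
      using circle_COP_orient_nonneg[OF co \<sigma> abc] by (intro LIMSEQ_le_const) auto
    \<comment> \<open>Distinct points of the circle are not collinear: by totality one of the two
      orientations is positive.\<close>
    moreover have "orient (l a) (l b) (l c) \<noteq> 0"
      using circular_order_total[OF circular_order_circle mem mem mem, OF X ne]
        circle_order_iff_orient mem X orient_swap[of "l a" "l c" "l b"] by (metis less_irrefl neg_0_less_iff_less)
    ultimately show ?thesis
      using circle_order_iff_orient mem X by simp
  qed
  have cop2: "l constant_on circ_interval X R x y \<or> l constant_on circ_interval X R y x"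
    if X: "x \<in> X" "y \<in> X" and eq: "l x = l y" for x y
  proof (rule ccontr)
    assume no: "\<not> ?thesis"
    then obtain u where "u \<in> circ_interval X R x y" "l u \<noteq> l x"
      unfolding constant_on_def by metis
    then have u: "u \<in> X" "(x, u, y) \<in> R" "l u \<noteq> l x"
      using eq by (auto simp: circ_interval_def)
    from no obtain v where "v \<in> circ_interval X R y x" "l v \<noteq> l x"
      unfolding constant_on_def by metis
    then have v: "v \<in> X" "(y, v, x) \<in> R" "l v \<noteq> l x"
      using eq by (auto simp: circ_interval_def)
    \<comment> \<open>For points of the unit circle this quantity is minus the squared distance of
      \<open>l w\<close> and \<open>l x\<close>.\<close>
    have neg: "Re (cnj (l w - l x) * (l x + l x)) < 0" if "w \<in> X" "l w \<noteq> l x" for w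
    proof -
      have "(Re (l w))\<^sup>2 + (Im (l w))\<^sup>2 = 1" "(Re (l x))\<^sup>2 + (Im (l x))\<^sup>2 = 1"
        using mem[OF that(1)] mem[OF X(1)] by (simp_all flip: cmod_power2)
      then have "Re (cnj (l w - l x) * (l x + l x)) = - ((Re (l w) - Re (l x))\<^sup>2 + (Im (l w) - Im (l x))\<^sup>2)"
        by simp algebra
      also have "\<dots> < 0"
        using that(2) by (simp only: neg_less_0_iff_less sum_power2_gt_zero_iff) (simp add: complex_eq_iff)
      finally show ?thesis .
    qed
    have "(\<lambda>n. Re (cnj (\<sigma> n u - \<sigma> n x) * (\<sigma> n x + \<sigma> n y))) \<longlonglongrightarrow> Re (cnj (l u - l x) * (l x + l y))"
      using X u by (intro tendsto_intros lim)
    then have "\<forall>\<^sub>F n in sequentially. Re (cnj (\<sigma> n u - \<sigma> n x) * (\<sigma> n x + \<sigma> n y)) < 0"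
      by (rule order_tendstoD) (use neg u eq in metis)
    moreover have "(\<lambda>n. Re (cnj (\<sigma> n v - \<sigma> n y) * (\<sigma> n y + \<sigma> n x))) \<longlonglongrightarrow> Re (cnj (l v - l y) * (l y + l x))"
      using X v by (intro tendsto_intros lim)
    then have "\<forall>\<^sub>F n in sequentially. Re (cnj (\<sigma> n v - \<sigma> n y) * (\<sigma> n y + \<sigma> n x)) < 0"
      by (rule order_tendstoD) (use neg v eq in metis)
    moreover have "(\<lambda>n. Re (\<sigma> n y * cnj (\<sigma> n x))) \<longlonglongrightarrow> Re (l y * cnj (l x))"
      using X by (intro tendsto_intros lim)
    \<comment> \<open>As \<open>l x = l y\<close>, the limit is the squared norm of
      \<open>l x\<close>, that is \<open>1\<close>.\<close>
    then have "\<forall>\<^sub>F n in sequentially. Re (\<sigma> n y * cnj (\<sigma> n x)) > 0"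
      by (rule order_tendstoD) (use mem X eq in \<open>simp add: complex_norm_square[symmetric]\<close>)
    ultimately have "\<forall>\<^sub>F n in sequentially. False"
      by eventually_elim (use circle_COP_close_endpoints[OF co \<sigma> u(2) v(2)] in fastforce)
    then show False by simp
  qed
  show ?thesis
    using l cop1 cop2 by (simp add: COP_maps_def)
qed

section \<open>Monotone angle functions of COP maps\<close>

lemma Arg2pi_cis: "0 \<le> t \<Longrightarrow> t < 2 * pi \<Longrightarrow> Arg2pi (cis t) = t"
  by (rule Arg2pi_unique[of 1]) (auto simp: cis_conv_exp)

text \<open>Dividing by \<open>p\<close> rotates \<open>p\<close> to angle \<open>0\<close>, from
  which the other two angles are measured within a single turn.\<close>

lemma circle_order_imp_Arg2pi_less:
  assumes "(p, q, r) \<in> circle_order"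
  shows "Arg2pi (q / p) < Arg2pi (r / p)"
proof -
  obtain \<alpha> \<beta> \<gamma> where *: "p = cis \<alpha>" "q = cis \<beta>" "r = cis \<gamma>" "\<alpha> < \<beta>" "\<beta> < \<gamma>" "\<gamma> < \<alpha> + 2 * pi"
    using assms unfolding circle_order_def by auto
  then have "Arg2pi (q / p) = \<beta> - \<alpha>" "Arg2pi (r / p) = \<gamma> - \<alpha>"
    by (auto simp: cis_divide intro!: Arg2pi_cis)
  with * show ?thesis by simp
qed

text \<open>\<open>h x\<close> is the counterclockwise angle from \<open>f x0\<close> to
  \<open>f x\<close>. By (COP2), the points with value \<open>f x0\<close> form an initial and a
  final segment of the cut order; between them (COP1) makes the angle increase.\<close>

lemma circle_COP_monotone_lift:
  assumes co: "circular_order X R" and f: "f \<in> circle_COP X R" and x0: "x0 \<in> X"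
  obtains h where "\<And>x. x \<in> X \<Longrightarrow> f x = f x0 * cis (h x)" "\<And>x. x \<in> X \<Longrightarrow> \<bar>h x\<bar> \<le> 2 * pi"
    "\<And>x y. x \<in> X \<Longrightarrow> y \<in> X \<Longrightarrow> cut_less R x0 x y \<Longrightarrow> h x \<le> h y"
proof -
  \<comment> \<open>\<open>left\<close> is meant as a past tense: before \<open>x\<close>,
    \<open>f\<close> has already moved away from the value \<open>f x0\<close>.\<close>
  define left where "left x \<longleftrightarrow> (\<exists>u\<in>X. cut_less R x0 u x \<and> f u \<noteq> f x0)" for x
  \<comment> \<open>Where \<open>f\<close> has returned to \<open>f x0\<close> after a full turn, the angle must be \<open>2 * pi\<close>, not \<open>0\<close>.\<close>
  define h where "h x = (if f x \<noteq> f x0 then Arg2pi (f x / f x0) else if left x then 2 * pi else 0)" for x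
  have range: "0 \<le> h x" "h x \<le> 2 * pi" for x
    using Arg2pi_ge_0[of "f x / f x0"] Arg2pi_lt_2pi[of "f x / f x0"] by (auto simp: h_def)
  have norm: "norm (f x) = 1" if "x \<in> X" for x
    using f that unfolding COP_maps_def by auto
  then have nz: "f x0 \<noteq> 0"
    using x0 by force
  have lift: "f x = f x0 * cis (h x)" if "x \<in> X" for x
  proof (cases "f x = f x0")
    case True
    then show ?thesis by (auto simp: h_def complex_eq_iff)
  next
    case False
    have "f x / f x0 = cis (Arg2pi (f x / f x0))"
      using Arg2pi_eq[of "f x / f x0"] norm[OF that] norm[OF x0]
      by (simp add: norm_divide cis_conv_exp mult.commute)
    then show ?thesis
      using False nz by (simp add: h_def field_simps)
  qed
  have mono: "h x \<le> h y" if X: "x \<in> X" "y \<in> X" and less: "cut_less R x0 x y" for x y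
  proof (cases "f y = f x0")
    case True
    show ?thesis
    proof (cases "left y")
      case True
      then show ?thesis using \<open>f y = f x0\<close> range by (simp add: h_def)
    next
      case False
      then have "f x = f x0" "\<not> left x"
        using less X cut_less_trans[OF co] by (auto simp: left_def)
      then show ?thesis using range by (simp add: h_def)
    qed
  next
    case y: False
    show ?thesis
    proof (cases "f x = f x0")
      case True
      \<comment> \<open>Otherwise \<open>u\<close> before \<open>x\<close> and \<open>y\<close>
        after \<open>x\<close> both have values other than \<open>f x0\<close>, so \<open>f\<close>
        is constant on neither arc between \<open>x0\<close> and \<open>x\<close>, against
        (COP2).\<close>
      have "\<not> left x"
      proof
        assume "left x"
        then obtain u where u: "u \<in> X" "cut_less R x0 u x" "f u \<noteq> f x0"
          by (auto simp: left_def)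
        then have "(x0, u, x) \<in> R" by (auto simp: cut_less_def)
        moreover have "x \<noteq> x0"
          using calculation circular_order_distinct[OF co] by blast
        then have "(x, y, x0) \<in> R"
          using less circular_order_cyclic[OF co] by (auto simp: cut_less_def)
        ultimately show False
          using COP_maps_constant[OF f x0 X(1)] True u y X by metis
      qed
      then show ?thesis using True range by (simp add: h_def)
    next
      case x: False
      then have "(x0, x, y) \<in> R" using less by (auto simp: cut_less_def)
      show ?thesis
      proof (cases "f x = f y")
        case True
        then show ?thesis using x y by (simp add: h_def)
      next
        case False
        then have "(f x0, f x, f y) \<in> circle_order"
          using f x y \<open>(x0, x, y) \<in> R\<close> unfolding COP_maps_def by fastforce
        then show ?thesis
          using circle_order_imp_Arg2pi_less x y by (simp add: h_def less_imp_le)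
      qed
    qed
  qed
  show ?thesis
    using that[of h] lift range mono by simp
qed

lemma circle_COP_seq_compact:
  assumes co: "circular_order X R"
  shows "seq_compact_space (pointwise_topology X (top_of_set unit_circle) (circle_COP X R))"
proof (rule seq_compact_space_pointwise)
  show "circle_COP X R \<subseteq> X \<rightarrow>\<^sub>E topspace (top_of_set unit_circle)"
    by (auto simp: COP_maps_def)
next
  fix x0 and \<sigma> :: "nat \<Rightarrow> 'a \<Rightarrow> complex"
  assume x0: "x0 \<in> X" and "range \<sigma> \<subseteq> circle_COP X R"
  then have \<sigma>: "\<And>n. \<sigma> n \<in> circle_COP X R" by blast
  then have mem: "\<And>n x. x \<in> X \<Longrightarrow> \<sigma> n x \<in> unit_circle"
    unfolding COP_maps_def by blast
  have "\<exists>h. (\<forall>x\<in>X. \<sigma> n x = \<sigma> n x0 * cis (h x)) \<and> (\<forall>x\<in>X. \<bar>h x\<bar> \<le> 2 * pi) \<and>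
      (\<forall>x\<in>X. \<forall>y\<in>X. cut_less R x0 x y \<longrightarrow> h x \<le> h y)" for n
    using circle_COP_monotone_lift[OF co \<sigma> x0, of n] by metis
  then obtain h where lift: "\<And>n x. x \<in> X \<Longrightarrow> \<sigma> n x = \<sigma> n x0 * cis (h n x)"
    and bdd: "\<And>n x. x \<in> X \<Longrightarrow> \<bar>h n x\<bar> \<le> 2 * pi"
    and mono: "\<And>n x y. x \<in> X \<Longrightarrow> y \<in> X \<Longrightarrow> cut_less R x0 x y \<Longrightarrow> h n x \<le> h n y"
    by metis
  obtain r where r: "strict_mono r" and "\<And>x. x \<in> X \<Longrightarrow> convergent (\<lambda>n. h (r n) x)"
    using Helly_monotone[of X "cut_less R x0" h "2 * pi"] cut_less_total[OF co x0] mono bdd by blast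
  then obtain v where v: "\<And>x. x \<in> X \<Longrightarrow> (\<lambda>n. h (r n) x) \<longlonglongrightarrow> v x"
    unfolding convergent_def by metis
  \<comment> \<open>The angles only describe \<open>\<sigma> n\<close> relative to its value at
    \<open>x0\<close>; compactness of the circle makes these base values converge along a further
    subsequence.\<close>
  obtain p r' where r': "strict_mono r'" and "((\<lambda>n. \<sigma> (r n) x0) \<circ> r') \<longlonglongrightarrow> p"
    using seq_compactE[OF compact_imp_seq_compact[OF compact_sphere], of "\<lambda>n. \<sigma> (r n) x0" 0 1] mem[OF x0]
    by metis
  then have p: "(\<lambda>n. \<sigma> (r (r' n)) x0) \<longlonglongrightarrow> p"
    by (simp add: comp_def)
  have "limitin (top_of_set unit_circle) (\<lambda>n. \<sigma> ((r \<circ> r') n) x) (p * cis (v x)) sequentially"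
    if x: "x \<in> X" for x
  proof -
    have "(\<lambda>n. \<sigma> (r (r' n)) x0 * cis (h (r (r' n)) x)) \<longlonglongrightarrow> p * cis (v x)"
      using LIMSEQ_subseq_LIMSEQ[OF v[OF x] r'] p by (intro tendsto_intros) (auto simp: comp_def)
    then have lim: "(\<lambda>n. \<sigma> (r (r' n)) x) \<longlonglongrightarrow> p * cis (v x)"
      using lift[OF x] by simp
    then have "p * cis (v x) \<in> unit_circle"
      using mem[OF x] closed_sphere closed_sequentially by metis
    then show ?thesis
      using lim mem[OF x] by (simp add: limitin_subtopology)
  qed
  then show "\<exists>r l. strict_mono (r :: nat \<Rightarrow> nat) \<and>
      (\<forall>x\<in>X. limitin (top_of_set unit_circle) (\<lambda>n. \<sigma> (r n) x) (l x) sequentially)"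
    by (intro exI[of _ "r \<circ> r'"] exI[of _ "\<lambda>x. p * cis (v x)"] conjI ballI strict_mono_o[OF r r'])
next
  fix \<sigma> :: "nat \<Rightarrow> 'a \<Rightarrow> complex" and l
  assume \<sigma>: "range \<sigma> \<subseteq> circle_COP X R" and l: "l \<in> X \<rightarrow>\<^sub>E topspace (top_of_set unit_circle)"
    and lim: "\<And>x. x \<in> X \<Longrightarrow> limitin (top_of_set unit_circle) (\<lambda>n. \<sigma> n x) (l x) sequentially"
  show "l \<in> circle_COP X R"
  proof (rule circle_COP_closed[OF co])
    show "\<sigma> n \<in> circle_COP X R" for n
      using \<sigma> by blast
    show "l \<in> X \<rightarrow>\<^sub>E unit_circle"
      using l by simp
    show "(\<lambda>n. \<sigma> n x) \<longlonglongrightarrow> l x" if "x \<in> X" for x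
      using lim[OF that] by (simp add: limitin_subtopology)
  qed
qed

theorem theorem12p14:
  fixes X :: "'a set" and R :: "('a \<times> 'a \<times> 'a) set"
    and Y :: "'b set" and d :: "'b \<Rightarrow> 'b \<Rightarrow> real"
  assumes "circular_order X R"
    and "Metric_space Y d"
    and "compact_space (Metric_space.mtopology Y d)"
  shows "(\<forall>t>0. seq_compact_space
            (pointwise_topology X (Metric_space.mtopology Y d) (BV_circ X R Y d t))) \<and>
         seq_compact_space
            (pointwise_topology X (top_of_set unit_circle) (COP_maps X R unit_circle circle_order))"
  using Metric_space.BV_circ_seq_compact[OF assms(2,1,3)] circle_COP_seq_compact[OF assms(1)] by blast

end
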